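(* Let $\{f_i\}_{i=1}^k$ be a frame for $\mathcal{H}^n$ and let $\{h_i\}_{i=1}^k$ be a dual frame of $\{f_i\}_{i=1}^k$. If $\{g_i\}_{i=1}^k$ is the canonical dual frame of $\{f_i\}_{i=1}^k$, then $$\sum_{i=1}^k|\langle f,g_i\rangle|\le\sqrt{k}\,\sum_{i=1}^k|\langle f,h_i\rangle|\qquad\text{for all } f\in\mathcal{H}^n.$$
   Context: $\mathcal{H}^n$ denotes $\mathbb{R}^n$ or $\mathbb{C}^n$. A finite sequence $F=\{f_i\}_{i=1}^k$ in $\mathcal{H}^n$ is a frame for $\mathcal{H}^n$ if there are constants $A,B>0$ with $A\|f\|^2\le\sum_{i=1}^k|\langle f,f_i\rangle|^2\le B\|f\|^2$ for all $f\in\mathcal{H}^n$. A frame $\{h_i\}_{i=1}^k$ is a dual frame of $F$ if $f=\sum_{i=1}^k\langle f,f_i\rangle h_i$ for all $f\in\mathcal{H}^n$. The frame operator is $S_Fx=\sum_{i=1}^k\langle x,f_i\rangle f_i$ (invertible), and the canonical dual frame is $\{S_F^{-1}f_i\}_{i=1}^k$. *)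

theory Defs
  imports "HOL-Analysis.Analysis" "Jordan_Normal_Form.Conjugate"
begin

text \<open>
  Conjugation is the identity on the reals and complex conjugation on the complex numbers, so the
  definitions below cover both scalar fields. The scalar product \<^term>\<open>inner\<close> of the library is
  real-valued also on complex vectors, hence it cannot be used in the complex case.
\<close>

definition hinner :: "'a::{conjugatable_field,real_normed_field} ^ 'n \<Rightarrow> 'a ^ 'n \<Rightarrow> 'a" where
  "hinner x y = (\<Sum>j\<in>UNIV. x $ j * conjugate (y $ j))"

lemma hinner_real: "hinner x y = x \<bullet> (y :: real ^ 'n)"
  by (simp add: hinner_def inner_vec_def)

lemma hinner_complex: "hinner x y = (\<Sum>j\<in>UNIV. x $ j * cnj (y $ j))"
  by (simp add: hinner_def)

lemma hinner_complex_self: "hinner x x = complex_of_real ((norm (x :: complex ^ 'n))\<^sup>2)"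
  by (simp add: hinner_def norm_vec_def L2_set_def sum_nonneg complex_norm_square
      del: of_real_power)

text \<open>
  A finite sequence of length \<open>k\<close> is a function on \<^typ>\<open>nat\<close>, of which only the values at
  \<open>1, \<dots>, k\<close> are used.
\<close>

definition is_frame ::
  "nat \<Rightarrow> (nat \<Rightarrow> 'a::{conjugatable_field,real_normed_field} ^ 'n) \<Rightarrow> bool" where
  "is_frame k F \<longleftrightarrow> (\<exists>A>0. \<exists>B>0. \<forall>x.
     A * (norm x)\<^sup>2 \<le> (\<Sum>i=1..k. (norm (hinner x (F i)))\<^sup>2) \<and>
     (\<Sum>i=1..k. (norm (hinner x (F i)))\<^sup>2) \<le> B * (norm x)\<^sup>2)"

definition is_dual_frame ::
  "nat \<Rightarrow> (nat \<Rightarrow> 'a::{conjugatable_field,real_normed_field} ^ 'n) \<Rightarrow> (nat \<Rightarrow> 'a ^ 'n) \<Rightarrow> bool"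
where
  "is_dual_frame k F H \<longleftrightarrow> is_frame k H \<and> (\<forall>x. x = (\<Sum>i=1..k. hinner x (F i) *s H i))"

definition frame_operator ::
  "nat \<Rightarrow> (nat \<Rightarrow> 'a::{conjugatable_field,real_normed_field} ^ 'n) \<Rightarrow> 'a ^ 'n \<Rightarrow> 'a ^ 'n" where
  "frame_operator k F x = (\<Sum>i=1..k. hinner x (F i) *s F i)"

text \<open>The frame operator of a frame is bijective, so \<^const>\<open>inv\<close> is its genuine inverse there.\<close>

definition canonical_dual ::
  "nat \<Rightarrow> (nat \<Rightarrow> 'a::{conjugatable_field,real_normed_field} ^ 'n) \<Rightarrow> nat \<Rightarrow> 'a ^ 'n" where
  "canonical_dual k F i = inv (frame_operator k F) (F i)"

end

theory Submission
  imports Defs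
begin

text \<open>
  Put \<open>a\<^sub>i = \<langle>x, g\<^sub>i\<rangle>\<close>, \<open>b\<^sub>i = \<langle>x, h\<^sub>i\<rangle>\<close> and \<open>y = S\<inverse> x\<close>, so that \<open>a\<^sub>i = \<langle>y, f\<^sub>i\<rangle>\<close> because \<open>S\<close> is
  self-adjoint. Expanding \<open>\<langle>y, x\<rangle>\<close> once with \<open>x = S y\<close> and once with the dual frame expansion of \<open>y\<close>
  gives \<open>\<Sum> \<bar>a\<^sub>i\<bar>\<^sup>2 = \<Sum> a\<^sub>i conj b\<^sub>i\<close>, and the Cauchy-Schwarz inequality yields
  \<open>\<parallel>a\<parallel>\<^sub>2 \<le> \<parallel>b\<parallel>\<^sub>2\<close>. Finally \<open>\<parallel>a\<parallel>\<^sub>1 \<le> \<surd>k \<parallel>a\<parallel>\<^sub>2\<close> and \<open>\<parallel>b\<parallel>\<^sub>2 \<le> \<parallel>b\<parallel>\<^sub>1\<close>.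
\<close>

text \<open>Cauchy-Schwarz against the constant sequence 1.\<close>

lemma sum_le_sqrt_card_mult_L2_set: "sum f A \<le> sqrt (real (card A)) * L2_set f A"
proof -
  have "sum f A \<le> (\<Sum>i\<in>A. \<bar>1\<bar> * \<bar>f i\<bar>)"
    by (intro sum_mono) simp
  also have "\<dots> \<le> L2_set (\<lambda>_. 1) A * L2_set f A"
    by (rule L2_set_mult_ineq)
  finally show ?thesis
    by (simp add: L2_set_def)
qed

lemma L2_set_le_if_sum_squares_le_sum_mult:
  assumes "(\<Sum>i\<in>A. (a i)\<^sup>2) \<le> (\<Sum>i\<in>A. \<bar>a i\<bar> * \<bar>b i\<bar>)"
  shows "L2_set a A \<le> L2_set b A"
proof -
  have "L2_set a A * L2_set a A = (\<Sum>i\<in>A. (a i)\<^sup>2)"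
    by (simp add: L2_set_def sum_nonneg)
  also have "\<dots> \<le> L2_set a A * L2_set b A"
    using assms L2_set_mult_ineq by (rule order_trans)
  finally show ?thesis
    using L2_set_nonneg[of a A] L2_set_nonneg[of b A]
    \<comment> \<open>The common factor cancels only if it is nonzero; if it vanishes, the claim is
      the nonnegativity of \<open>L2_set b A\<close>.\<close>
    by (cases "L2_set a A = 0") (simp_all add: mult_le_cancel_left)
qed

lemma hinner_add_left: "hinner (x + y) z = hinner x z + hinner y z"
  by (simp add: hinner_def sum.distrib distrib_right)

lemma hinner_scale_left: "hinner (c *s x) z = c * hinner x z"
  by (simp add: hinner_def sum_distrib_left mult.assoc)

lemma hinner_sum_left: "hinner (\<Sum>i\<in>A. f i) z = (\<Sum>i\<in>A. hinner (f i) z)"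
  by (simp add: hinner_def sum_distrib_right sum.swap[of _ UNIV A])

lemma hinner_commute: "hinner y x = conjugate (hinner x y)"
  by (simp add: hinner_def sum_conjugate conjugate_dist_mul mult.commute)

lemma hinner_frame_operator_left:
  "hinner (frame_operator k F x) z = (\<Sum>i=1..k. hinner x (F i) * hinner (F i) z)"
  by (simp add: frame_operator_def hinner_sum_left hinner_scale_left)

text \<open>Self-adjointness of the frame operator.\<close>

lemma hinner_frame_operator_right:
  "hinner x (frame_operator k F z) = hinner (frame_operator k F x) z"
proof -
  have "hinner x (frame_operator k F z)
      = (\<Sum>i=1..k. conjugate (hinner z (F i)) * conjugate (hinner (F i) x))"
    by (subst hinner_commute)
      (simp add: hinner_frame_operator_left sum_conjugate conjugate_dist_mul)
  also have "\<dots> = (\<Sum>i=1..k. hinner x (F i) * hinner (F i) z)"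
    by (simp add: hinner_commute[symmetric] mult.commute)
  finally show ?thesis
    by (simp add: hinner_frame_operator_left)
qed

lemma linear_frame_operator: "Vector_Spaces.linear (*s) (*s) (frame_operator k F)"
  by unfold_locales
    (simp_all add: frame_operator_def hinner_add_left hinner_scale_left sum.distrib
      vec.scale_left_distrib vec.scale_sum_right)

text \<open>
  The type classes do not relate \<^const>\<open>norm\<close> and \<^const>\<open>conjugate\<close>; the locale supplies the
  relation, which holds for both scalar fields.
\<close>

locale norm_conjugate =
  fixes scalar :: "'a::{conjugatable_field,real_normed_field} itself"
  assumes mult_conjugate: "z * conjugate z = of_real ((norm (z::'a))\<^sup>2)"
begin

lemma norm_conjugate: "norm (conjugate (z::'a)) = norm z"
proof (cases "z = 0")
  case False
  have "norm z * norm (conjugate z) = (norm z)\<^sup>2"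
    by (simp flip: norm_mult add: mult_conjugate del: of_real_power)
  with False show ?thesis
    by (simp add: power2_eq_square)
qed simp

lemma hinner_frame_operator_self:
  "hinner (frame_operator k F (x :: 'a ^ 'n)) x = of_real (\<Sum>i=1..k. (norm (hinner x (F i)))\<^sup>2)"
  by (simp add: hinner_frame_operator_left hinner_commute[of "F _" x] mult_conjugate
      del: of_real_power)

text \<open>If the operator kills \<open>x\<close>, its quadratic form vanishes at \<open>x\<close>,
  and the lower frame bound forces \<open>x = 0\<close>. In finite dimension this injectivity gives
  surjectivity.\<close>

lemma surj_frame_operator:
  fixes F :: "nat \<Rightarrow> 'a ^ 'n"
  assumes "is_frame k F"
  shows "surj (frame_operator k F)"
proof -
  interpret S: Vector_Spaces.linear "(*s)" "(*s)" "frame_operator k F"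
    by (rule linear_frame_operator)
  obtain A where "A > 0"
    and A: "\<And>x. A * (norm x)\<^sup>2 \<le> (\<Sum>i=1..k. (norm (hinner x (F i)))\<^sup>2)"
    using assms unfolding is_frame_def by blast
  have "x = 0" if "frame_operator k F x = 0" for x
  proof -
    have "(of_real (\<Sum>i=1..k. (norm (hinner x (F i)))\<^sup>2) :: 'a) = hinner 0 x"
      using that hinner_frame_operator_self[of k F x] by simp
    also have "\<dots> = of_real 0"
      by (simp add: hinner_def)
    finally have "A * (norm x)\<^sup>2 \<le> 0"
      using A[of x] by (simp only: of_real_eq_iff)
    with \<open>A > 0\<close> show ?thesis
      by (simp add: mult_le_0_iff)
  qed
  then have "inj (frame_operator k F)"
    by (simp add: S.inj_iff_eq_0)
  then show ?thesis
    by (rule vec.linear_injective_imp_surjective[OF linear_frame_operator _ refl])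
qed

text \<open>Self-adjointness moves the operator onto the dual vector, where it cancels
  \<open>inv\<close>; for this order of composition surjectivity is enough.\<close>

lemma hinner_canonical_dual:
  fixes F :: "nat \<Rightarrow> 'a ^ 'n"
  assumes "is_frame k F"
  shows "hinner (frame_operator k F y) (canonical_dual k F i) = hinner y (F i)"
  using surj_f_inv_f[OF surj_frame_operator[OF assms]]
  by (simp add: canonical_dual_def flip: hinner_frame_operator_right)

lemma L2_set_canonical_dual_le:
  fixes F :: "nat \<Rightarrow> 'a ^ 'n"
  assumes F: "is_frame k F" and H: "is_dual_frame k F H"
  shows "L2_set (\<lambda>i. norm (hinner x (canonical_dual k F i))) {1..k}
    \<le> L2_set (\<lambda>i. norm (hinner x (H i))) {1..k}"
proof -
  obtain y where x: "x = frame_operator k F y"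
    using surj_frame_operator[OF F] by (metis surjD)
  have y: "y = (\<Sum>i=1..k. hinner y (F i) *s H i)"
    using H by (simp add: is_dual_frame_def)
  have "of_real (\<Sum>i=1..k. (norm (hinner y (F i)))\<^sup>2) = hinner y x"
    unfolding x by (simp only: hinner_frame_operator_right hinner_frame_operator_self)
  also have "\<dots> = (\<Sum>i=1..k. hinner y (F i) * conjugate (hinner x (H i)))"
    \<comment> \<open>Only the left argument is expanded in the dual frame; the coefficients keep
      \<open>y\<close>.\<close>
    by (subst y) (simp add: hinner_sum_left hinner_scale_left flip: hinner_commute)
  finally have "norm (of_real (\<Sum>i=1..k. (norm (hinner y (F i)))\<^sup>2) :: 'a)
      \<le> (\<Sum>i=1..k. norm (hinner y (F i) * conjugate (hinner x (H i))))"
    by (simp only: norm_sum)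
  then have "(\<Sum>i=1..k. (norm (hinner y (F i)))\<^sup>2)
      \<le> (\<Sum>i=1..k. \<bar>norm (hinner y (F i))\<bar> * \<bar>norm (hinner x (H i))\<bar>)"
    by (simp add: norm_mult norm_conjugate sum_nonneg del: of_real_sum of_real_power)
  then show ?thesis
    unfolding x hinner_canonical_dual[OF F] by (rule L2_set_le_if_sum_squares_le_sum_mult)
qed

lemma sum_norm_canonical_dual_le:
  fixes F :: "nat \<Rightarrow> 'a ^ 'n"
  assumes "is_frame k F" and "is_dual_frame k F H" and "\<forall>i\<in>{1..k}. G i = canonical_dual k F i"
  shows "(\<Sum>i=1..k. norm (hinner x (G i))) \<le> sqrt (real k) * (\<Sum>i=1..k. norm (hinner x (H i)))"
proof -
  have "(\<Sum>i=1..k. norm (hinner x (G i)))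
      \<le> sqrt (real k) * L2_set (\<lambda>i. norm (hinner x (G i))) {1..k}"
    using sum_le_sqrt_card_mult_L2_set[of _ "{1..k}"] by simp
  also have "L2_set (\<lambda>i. norm (hinner x (G i))) {1..k}
      = L2_set (\<lambda>i. norm (hinner x (canonical_dual k F i))) {1..k}"
    \<comment> \<open>\<open>G\<close> is prescribed only on the indices from 1 to \<open>k\<close>,
      so the two sequences agree just there.\<close>
    using assms(3) by (intro L2_set_cong) simp_all
  also have "\<dots> \<le> L2_set (\<lambda>i. norm (hinner x (H i))) {1..k}"
    using assms(1,2) by (rule L2_set_canonical_dual_le)
  also have "\<dots> \<le> (\<Sum>i=1..k. norm (hinner x (H i)))"
    by (rule L2_set_le_sum) simp
  finally show ?thesis
    by (simp add: mult_left_mono)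
qed

end

interpretation real: norm_conjugate "TYPE(real)"
  by unfold_locales (simp add: power2_eq_square)

interpretation complex: norm_conjugate "TYPE(complex)"
  by unfold_locales (simp add: complex_norm_square del: of_real_power)

theorem proposition5p2:
  shows "(\<forall>(k::nat) (f :: nat \<Rightarrow> real ^ 'n) h g.
            is_frame k f \<longrightarrow> is_dual_frame k f h \<longrightarrow> (\<forall>i\<in>{1..k}. g i = canonical_dual k f i) \<longrightarrow>
            (\<forall>x. (\<Sum>i=1..k. norm (hinner x (g i))) \<le> sqrt (real k) * (\<Sum>i=1..k. norm (hinner x (h i)))))
       \<and> (\<forall>(k::nat) (f :: nat \<Rightarrow> complex ^ 'n) h g.
            is_frame k f \<longrightarrow> is_dual_frame k f h \<longrightarrow> (\<forall>i\<in>{1..k}. g i = canonical_dual k f i) \<longrightarrow>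
            (\<forall>x. (\<Sum>i=1..k. norm (hinner x (g i))) \<le> sqrt (real k) * (\<Sum>i=1..k. norm (hinner x (h i)))))"
  using real.sum_norm_canonical_dual_le complex.sum_norm_canonical_dual_le by blast

end
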